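(* Fix $\beta$ with $1<\beta\le 2$. Let $(x_n)_{n\ge1}$ be a real sequence such that $x_{n+1}-x_n\ge c$ for all $n$, for some constant $c>0$. Suppose that for every $\varepsilon>0$ there is a constant $C(\varepsilon)$ such that for all $N$, $$\sum_{1\le j_1,j_2< N^{\beta-\varepsilon}}\ \sum_{\substack{1\le m_1,m_2,n_1,n_2\le N\\ m_1\ne n_1,\ m_2\ne n_2}} \mathbb{1}\Big(\big|j_1(x_{m_1}-x_{n_1})-j_2(x_{m_2}-x_{n_2})\big|<1\Big)\le C(\varepsilon)N^{4-\varepsilon}.$$ Then for almost every $\alpha\in\mathbb{R}$, for every $\varepsilon>0$, $$\delta_{\min}^{\alpha}(N)\ll \frac{1}{N^{\beta-\varepsilon}},$$ where the implied constant may depend on $\alpha$ and $\varepsilon$.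
   Context: For $x\in\mathbb{R}$, $\|x\|=\min_{k\in\mathbb{Z}}|x-k|$. For $\alpha\in\mathbb{R}$ and $N\ge2$, $\delta_{\min}^{\alpha}(N)=\min\{\|\alpha x_m-\alpha x_n\| : 1\le m,n\le N,\ m\ne n\}$. $\mathbb{1}(\cdot)$ denotes the indicator of the stated condition. *)

theory Defs
  imports "HOL-Analysis.Analysis"
begin

definition dist_int :: "real \<Rightarrow> real" where
  "dist_int x = (INF k::int. \<bar>x - of_int k\<bar>)"

definition delta_min :: "real \<Rightarrow> (nat \<Rightarrow> real) \<Rightarrow> nat \<Rightarrow> real" where
  "delta_min \<alpha> x N = Min {dist_int (\<alpha> * x m - \<alpha> * x n) | m n.
      m \<in> {1..N} \<and> n \<in> {1..N} \<and> m \<noteq> n}"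

end

theory Submission
  imports Defs
begin

text \<open>
  With \<open>M \<approx> N powr (\<beta> - \<epsilon>)\<close>, \<open>g\<^sub>k = k (M - k)\<close> and \<open>h\<^sub>k = g\<^sub>k\<^sub>+\<^sub>1 - g\<^sub>k\<close>, summation by parts
  shows that \<open>P = lam \<bar>\<Sum> g\<^sub>k e(k t)\<bar>\<^sup>2 - \<bar>\<Sum> h\<^sub>k e(k t)\<bar>\<^sup>2\<close> equals
  \<open>(lam - \<bar>1 - e(t)\<bar>\<^sup>2) \<bar>\<Sum> g\<^sub>k e(k t)\<bar>\<^sup>2\<close>. For \<open>lam\<close> of order \<open>1 / M\<^sup>2\<close> this is a trigonometric
  polynomial of degree less than \<open>M\<close> that is nonpositive as soon as \<open>t\<close> has distance at least
  \<open>2 / M\<close> from the integers, although its mean is positive and of the order of its largest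
  coefficient. If \<open>delta_min \<alpha> x N\<close> exceeds \<open>2 / M\<close>, then summing \<open>P (\<alpha> (x m - x n))\<close> over
  \<open>m \<noteq> n\<close> shows that the contribution of the nonzero frequencies is at least \<open>N (N - 1)\<close>.
  The mean square of this contribution over a bounded interval, taken with a tent weight, is
  controlled by the number of pairs of frequencies in the same unit interval, that is, by the
  quantity in the hypothesis. So the exceptional set has measure \<open>O(N powr (- \<epsilon>))\<close>, and the
  Borel-Cantelli lemma along \<open>N = 2 ^ r\<close> together with the monotonicity of \<open>delta_min\<close> in \<open>N\<close>
  finishes the proof.
\<close>

section \<open>The minorant polynomial\<close>

lemma cmod_trig_sum_squared:
  fixes a :: "'i \<Rightarrow> real" and y :: "'i \<Rightarrow> real"
  assumes "finite I"
  shows "(cmod (\<Sum>i\<in>I. of_real (a i) * cis (y i)))\<^sup>2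
       = (\<Sum>i\<in>I. \<Sum>k\<in>I. a i * a k * cos (y i - y k))"
proof -
  have "(cmod (\<Sum>i\<in>I. of_real (a i) * cis (y i)))\<^sup>2
      = (\<Sum>i\<in>I. a i * cos (y i))\<^sup>2 + (\<Sum>i\<in>I. a i * sin (y i))\<^sup>2"
    by (simp add: cmod_power2)
  also have "\<dots> = (\<Sum>i\<in>I. \<Sum>k\<in>I. a i * a k * cos (y i - y k))"
    unfolding power2_eq_square sum_product
    by (simp add: cos_diff algebra_simps flip: sum.distrib)
  finally show ?thesis .
qed

lemma norm_one_minus_cis_squared: "(cmod (1 - cis \<theta>))\<^sup>2 = 2 - 2 * cos \<theta>"
proof -
  have "(cmod (1 - cis \<theta>))\<^sup>2 = (1 - cos \<theta>)\<^sup>2 + (sin \<theta>)\<^sup>2"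
    by (simp add: cmod_power2)
  also have "\<dots> = 2 - 2 * cos \<theta>"
    by (simp add: sin_squared_eq power2_eq_square algebra_simps)
  finally show ?thesis .
qed

definition parab :: "nat \<Rightarrow> nat \<Rightarrow> real" where
  "parab M k = real k * (real M - real k)"

definition parab_diff :: "nat \<Rightarrow> nat \<Rightarrow> real" where
  "parab_diff M k = real M - 1 - 2 * real k"

text \<open>Summation by parts: \<open>parab_diff\<close> is the forward difference of
  \<open>parab\<close>, and there are no boundary terms because
  \<open>parab M 0 = parab M M = 0\<close>.\<close>

lemma parab_diff_generating:
  fixes z :: complex
  shows "z * (\<Sum>k<M. of_real (parab_diff M k) * z ^ k)
       = (1 - z) * (\<Sum>k<M. of_real (parab M k) * z ^ k)"
proof -
  have shift: "(\<Sum>k<M. of_real (parab M (Suc k)) * z ^ Suc k) = (\<Sum>k<M. of_real (parab M k) * z ^ k)"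
    using sum.lessThan_Suc_shift[of "\<lambda>k. of_real (parab M k) * z ^ k" M]
    by (simp add: parab_def)
  moreover have "of_real (parab_diff M k) = (of_real (parab M (Suc k)) - of_real (parab M k) :: complex)" for k
    unfolding parab_diff_def parab_def of_real_diff[symmetric]
    by (rule arg_cong[where f=of_real]) (simp add: algebra_simps)
  ultimately have "z * (\<Sum>k<M. of_real (parab_diff M k) * z ^ k)
      = (\<Sum>k<M. of_real (parab M (Suc k)) * z ^ Suc k) - z * (\<Sum>k<M. of_real (parab M k) * z ^ k)"
    by (simp add: sum_distrib_left left_diff_distrib right_diff_distrib sum_subtractf mult.left_commute)
  with shift show ?thesis by (simp add: left_diff_distrib)
qed

lemma sum_parab_squared: "30 * (\<Sum>k<M. (parab M k)\<^sup>2) = real M ^ 5 - real M"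
proof -
  \<comment> \<open>The summand itself depends on \<open>M\<close>, so the upper limit is decoupled:
    the closed form is proved for every \<open>n\<close> with \<open>M\<close> fixed and then taken
    at \<open>n = M\<close>. The next lemma proceeds in the same way.\<close>
  have "30 * (\<Sum>k<n. (parab M k)\<^sup>2)
      = 5 * real M^2 * real n * (real n - 1) * (2 * real n - 1)
        - 15 * real M * (real n)^2 * (real n - 1)^2
        + real n * (real n - 1) * (2 * real n - 1) * (3 * real n^2 - 3 * real n - 1)" for n
    by (induction n) (simp_all add: parab_def algebra_simps power2_eq_square power3_eq_cube)
  from this[of M] show ?thesis
    by (simp add: algebra_simps power2_eq_square eval_nat_numeral)
qed

lemma sum_parab_diff_squared: "3 * (\<Sum>k<M. (parab_diff M k)\<^sup>2) = real M * (real M ^ 2 - 1)"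
proof -
  have "3 * (\<Sum>k<n. (parab_diff M k)\<^sup>2)
      = 3 * real n * (real M - 1)^2 - 6 * (real M - 1) * real n * (real n - 1)
        + 2 * real n * (real n - 1) * (2 * real n - 1)" for n
    by (induction n) (simp_all add: parab_diff_def algebra_simps power2_eq_square)
  from this[of M] show ?thesis
    by (simp add: algebra_simps power2_eq_square)
qed

text \<open>The left side equals \<open>4 * (sin y)^2\<close>, where \<open>y\<close> is
  \<open>pi\<close> times the distance from \<open>t\<close> to a nearest integer. The constant 5 is
  not optimal; it is chosen because \<open>s = 2 / M\<close> then gives \<open>20 / M^2\<close>,
  which exceeds \<open>lam\<close> in the minorant.\<close>

lemma cos_two_pi_dist_int:
  assumes "dist_int t \<ge> s" and "s \<ge> 0"
  shows "2 - 2 * cos (2 * pi * t) \<ge> 5 * s\<^sup>2"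
proof -
  define u where "u = t - of_int (round t)"
  have "dist_int t \<le> \<bar>u\<bar>"
    unfolding dist_int_def u_def by (rule cINF_lower) (auto intro!: bdd_belowI[of _ 0])
  with assms have su: "s \<le> \<bar>u\<bar>" by simp
  have u: "\<bar>u\<bar> \<le> 1/2"
    unfolding u_def using of_int_round_abs_le[of t] by (simp add: abs_minus_commute)
  define y where "y = pi * \<bar>u\<bar>"
  have y0: "y \<ge> 0" by (simp add: y_def)
  have "y \<le> 3.2 * (1/2)"
    unfolding y_def using u pi_approx by (intro mult_mono) auto
  then have "y * y \<le> 1.6 * 1.6" using y0 by (intro mult_mono) auto
  then have y2: "y^2 \<le> 2.56" by (simp add: power2_eq_square)
  \<comment> \<open>Three Taylor terms give \<open>sin y >= y * (1 - y^2 / 6)\<close>, and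
    \<open>y^2 <= 2.56\<close> makes the bracket at least 1/2.\<close>
  have "\<bar>sin y - (\<Sum>m<3. sin_coeff m * y ^ m)\<bar> \<le> inverse (fact 3) * \<bar>y\<bar> ^ 3"
    by (rule Maclaurin_sin_bound)
  then have "sin y \<ge> y - y ^ 3 / 6"
    using y0 by (simp add: eval_nat_numeral sin_coeff_def fact_numeral abs_if split: if_splits)
  also have "y - y^3 / 6 = y * (1 - y^2 / 6)" by (simp add: algebra_simps eval_nat_numeral)
  finally have "sin y \<ge> y * (1 - y^2 / 6)" .
  moreover have "y * (1 - y^2 / 6) \<ge> y * (1/2)" using y2 y0 by (intro mult_left_mono) auto
  ultimately have "sin y \<ge> y * (1/2)" by linarith
  moreover have "y * (1/2) \<ge> 1.5 * s" unfolding y_def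
    using su pi_gt3 mult_mono[of 3 pi s "\<bar>u\<bar>"] assms by simp
  ultimately have "sin y \<ge> 1.5 * s" by linarith
  then have "(sin y)^2 \<ge> (1.5 * s)^2" using assms by (intro power_mono) auto
  then have "4 * (sin y)^2 \<ge> 9 * s^2" by (simp add: power_mult_distrib power_divide)
  then have 1: "4 * (sin y)^2 \<ge> 5 * s^2"
    using zero_le_power2[of s] by linarith
  have "cos (2 * pi * t) = cos (2 * pi * u + 2 * pi * of_int (round t))"
    by (simp add: u_def algebra_simps)
  also have "\<dots> = cos (2 * pi * u)"
    using cos_int_2pin[of "round t"] sin_int_2pin[of "round t"] by (simp add: cos_add)
  also have "\<dots> = cos (2 * y)"
    unfolding y_def by (cases "u \<ge> 0") (auto simp: algebra_simps)
  also have "\<dots> = 1 - 2 * (sin y)^2" by (rule cos_double_sin)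
  finally show ?thesis using 1 by simp
qed

text \<open>Since cosine is even, the terms can be grouped by \<open>j = |k - l|\<close>. A given
  \<open>j\<close> comes only from pairs \<open>(k, k + j)\<close> or \<open>(k + j, k)\<close>,
  hence from at most \<open>2 * M\<close> pairs; the diagonal \<open>j = 0\<close> is the
  mean.\<close>

lemma sum_by_difference:
  fixes w :: "nat \<Rightarrow> nat \<Rightarrow> real"
  assumes "\<And>k l. k < M \<Longrightarrow> l < M \<Longrightarrow> \<bar>w k l\<bar> \<le> b"
  obtains A where "\<And>j. \<bar>A j\<bar> \<le> 2 * real M * b"
    "\<And>\<theta>. (\<Sum>k<M. \<Sum>l<M. w k l * cos (real k * \<theta> - real l * \<theta>))
        = (\<Sum>k<M. w k k) + (\<Sum>j\<in>{1..<M}. A j * cos (real j * \<theta>))"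
proof (cases "M = 0")
  case True
  then show ?thesis by (intro that[of "\<lambda>_. 0"]) auto
next
  case False
  \<comment> \<open>Truncated subtraction makes at least one summand zero, so \<open>d\<close> is
    the absolute difference.\<close>
  define d :: "nat \<times> nat \<Rightarrow> nat" where "d = (\<lambda>(k,l). (k - l) + (l - k))"
  define S where "S = {..<M} \<times> {..<M}"
  define A where "A = (\<lambda>j. \<Sum>p\<in>{p\<in>S. d p = j}. w (fst p) (snd p))"
  have b: "b \<ge> 0" using assms[of 0 0] False by force
  have "\<bar>A j\<bar> \<le> 2 * real M * b" for j
  proof -
    have "{p\<in>S. d p = j} \<subseteq> (\<lambda>k. (k, k + j)) ` {..<M} \<union> (\<lambda>k. (k + j, k)) ` {..<M}"
    proof
      fix p assume p: "p \<in> {p\<in>S. d p = j}"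
      obtain k l where kl: "p = (k, l)" by (cases p)
      show "p \<in> (\<lambda>k. (k, k + j)) ` {..<M} \<union> (\<lambda>k. (k + j, k)) ` {..<M}"
        using p unfolding kl by (cases "k \<le> l") (auto simp: d_def S_def image_iff)
    qed
    then have "card {p\<in>S. d p = j} \<le> card ((\<lambda>k. (k, k + j)) ` {..<M} \<union> (\<lambda>k. (k + j, k)) ` {..<M})"
      by (intro card_mono) auto
    also have "\<dots> \<le> card ((\<lambda>k. (k, k + j)) ` {..<M}) + card ((\<lambda>k. (k + j, k)) ` {..<M})"
      by (rule card_Un_le)
    also have "\<dots> \<le> M + M"
      using card_image_le[of "{..<M}" "\<lambda>k. (k, k + j)"] card_image_le[of "{..<M}" "\<lambda>k. (k + j, k)"] by simp
    finally have c: "real (card {p\<in>S. d p = j}) \<le> 2 * real M" by simp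
    have "\<bar>A j\<bar> \<le> (\<Sum>p\<in>{p\<in>S. d p = j}. \<bar>w (fst p) (snd p)\<bar>)"
      unfolding A_def by (rule sum_abs)
    also have "\<dots> \<le> real (card {p\<in>S. d p = j}) * b"
      by (rule sum_bounded_above) (auto simp: S_def intro!: assms)
    also have "\<dots> \<le> 2 * real M * b" using c b by (rule mult_right_mono)
    finally show ?thesis .
  qed
  moreover have "(\<Sum>k<M. \<Sum>l<M. w k l * cos (real k * \<theta> - real l * \<theta>))
        = (\<Sum>k<M. w k k) + (\<Sum>j\<in>{1..<M}. A j * cos (real j * \<theta>))" for \<theta>
  proof -
    have c: "cos (real k * \<theta> - real l * \<theta>) = cos (real (d (k,l)) * \<theta>)" for k l
    proof (cases "k \<le> l")
      case True
      then have "cos (real k * \<theta> - real l * \<theta>) = cos (- (real (d (k,l)) * \<theta>))"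
        by (simp add: d_def of_nat_diff algebra_simps)
      then show ?thesis by (simp only: cos_minus)
    qed (simp add: d_def of_nat_diff algebra_simps)
    have "(\<Sum>k<M. \<Sum>l<M. w k l * cos (real k * \<theta> - real l * \<theta>))
        = (\<Sum>p\<in>S. w (fst p) (snd p) * cos (real (d p) * \<theta>))"
      by (simp add: S_def sum.cartesian_product c split_beta)
    also have "\<dots> = (\<Sum>j<M. \<Sum>p\<in>{p\<in>S. d p = j}. w (fst p) (snd p) * cos (real (d p) * \<theta>))"
      by (rule sum.group[symmetric]) (auto simp: S_def d_def)
    also have "\<dots> = (\<Sum>j<M. A j * cos (real j * \<theta>))"
      by (simp add: A_def sum_distrib_right)
    also have "\<dots> = A 0 + (\<Sum>j\<in>{1..<M}. A j * cos (real j * \<theta>))"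
      using False by (simp add: lessThan_atLeast0 sum.atLeast_Suc_lessThan)
    also have "A 0 = (\<Sum>k<M. w k k)"
    proof -
      have "{p\<in>S. d p = 0} = (\<lambda>k. (k, k)) ` {..<M}" by (auto simp: S_def d_def)
      then show ?thesis by (simp add: A_def sum.reindex inj_on_def)
    qed
    finally show ?thesis .
  qed
  ultimately show ?thesis by (rule that)
qed

text \<open>This is the polynomial \<open>P\<close> of the overview divided by its mean
  \<open>H\<close>. Its coefficients are at most \<open>6 * M^3\<close> and \<open>H\<close> is at
  least \<open>M^3 / 4\<close>, which gives the bound 24, uniform in \<open>M\<close>.\<close>

lemma minorant_polynomial:
  assumes M: "M \<ge> 2"
  obtains a :: "nat \<Rightarrow> real" where "\<And>j. \<bar>a j\<bar> \<le> 24"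
    "\<And>t. dist_int t \<ge> 2 / real M \<Longrightarrow> 1 + (\<Sum>j\<in>{1..<M}. a j * cos (real j * (2 * pi * t))) \<le> 0"
proof -
  define \<mu> where "\<mu> = real M"
  have \<mu>: "\<mu> \<ge> 2" using M by (simp add: \<mu>_def)
  \<comment> \<open>This choice of \<open>lam\<close> makes \<open>lam * (\<Sum>k<M. (parab M k)\<^sup>2)\<close> exactly twice \<open>\<Sum>k<M. (parab_diff M k)\<^sup>2\<close>.\<close>
  define lam where "lam = 20 / (\<mu>\<^sup>2 + 1)"
  have lam0: "lam \<ge> 0" by (simp add: lam_def)
  define w where "w = (\<lambda>k l. lam * (parab M k * parab M l) - parab_diff M k * parab_diff M l)"
  define H where "H = \<mu> * (\<mu>\<^sup>2 - 1) / 3"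
  have pos: "\<mu>\<^sup>2 + 1 > 0" by (simp add: add_nonneg_pos)
  have diag: "(\<Sum>k<M. w k k) = H"
  proof -
    have "(\<Sum>k<M. w k k) = lam * (\<Sum>k<M. (parab M k)\<^sup>2) - (\<Sum>k<M. (parab_diff M k)\<^sup>2)"
      by (simp add: w_def sum_subtractf sum_distrib_left power2_eq_square)
    also have "(\<Sum>k<M. (parab M k)\<^sup>2) = (\<mu>^5 - \<mu>) / 30"
      using sum_parab_squared[of M] by (simp add: \<mu>_def)
    also have "(\<Sum>k<M. (parab_diff M k)\<^sup>2) = \<mu> * (\<mu>\<^sup>2 - 1) / 3"
      using sum_parab_diff_squared[of M] by (simp add: \<mu>_def)
    also have "\<mu>^5 - \<mu> = \<mu> * (\<mu>\<^sup>2 - 1) * (\<mu>\<^sup>2 + 1)"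
      by (simp add: algebra_simps eval_nat_numeral)
    also have "lam * (\<mu> * (\<mu>\<^sup>2 - 1) * (\<mu>\<^sup>2 + 1) / 30) = 2 * H"
      using pos by (simp add: lam_def H_def)
    finally show ?thesis by (simp add: H_def)
  qed
  have H: "H \<ge> \<mu>^3 / 4"
  proof -
    have "\<mu>\<^sup>2 \<ge> 2\<^sup>2" using \<mu> by (intro power_mono) auto
    then have "\<mu> * ((\<mu>\<^sup>2 - 1) / 3) \<ge> \<mu> * (\<mu>\<^sup>2 / 4)" using \<mu> by (intro mult_left_mono) auto
    then show ?thesis by (simp add: H_def eval_nat_numeral)
  qed
  then have Hpos: "H > 0" using \<mu> by (smt (verit) zero_less_power divide_pos_pos)
  \<comment> \<open>The \<open>lam\<close> term lies between 0 and \<open>2 * \<mu>^2\<close>,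
    because \<open>parab\<close> is at most \<open>\<mu>^2 / 4\<close> and \<open>lam\<close> is
    less than \<open>20 / \<mu>^2\<close>; the other product has modulus at most
    \<open>\<mu>^2\<close>.\<close>
  have wb: "\<bar>w k l\<bar> \<le> 3 * \<mu>\<^sup>2" if "k < M" "l < M" for k l
  proof -
    have g: "0 \<le> parab M k \<and> parab M k \<le> \<mu>\<^sup>2 / 4" if "k < M" for k
    proof -
      have "0 \<le> (\<mu> - 2 * real k)\<^sup>2" by simp
      then have "parab M k \<le> \<mu>\<^sup>2 / 4" by (simp add: parab_def \<mu>_def power2_eq_square algebra_simps)
      moreover have "0 \<le> parab M k" using that by (simp add: parab_def)
      ultimately show ?thesis by simp
    qed
    have h: "\<bar>parab_diff M k\<bar> \<le> \<mu>" if "k < M" for k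
      using that by (auto simp: parab_diff_def \<mu>_def abs_if)
    have "parab M k * parab M l \<le> (\<mu>\<^sup>2 / 4) * (\<mu>\<^sup>2 / 4)"
      using g that by (intro mult_mono) auto
    then have "lam * (parab M k * parab M l) \<le> lam * ((\<mu>\<^sup>2 / 4) * (\<mu>\<^sup>2 / 4))"
      using lam0 by (rule mult_left_mono)
    also have "\<dots> = (20 / 16) * \<mu>\<^sup>2 * (\<mu>\<^sup>2 / (\<mu>\<^sup>2 + 1))"
      using pos by (simp add: lam_def field_simps eval_nat_numeral)
    also have "\<dots> \<le> (20 / 16) * \<mu>\<^sup>2 * 1"
      using pos by (intro mult_left_mono) (auto simp: divide_simps)
    finally have 1: "lam * (parab M k * parab M l) \<le> 2 * \<mu>\<^sup>2" 
      using zero_le_power2[of \<mu>] by linarith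
    have 2: "lam * (parab M k * parab M l) \<ge> 0" using g that lam0 by simp
    have "\<bar>parab_diff M k * parab_diff M l\<bar> \<le> \<mu> * \<mu>"
      unfolding abs_mult using h that \<mu> by (intro mult_mono) auto
    then show ?thesis using 1 2 unfolding w_def power2_eq_square by linarith
  qed
  obtain A where A: "\<And>j. \<bar>A j\<bar> \<le> 2 * real M * (3 * \<mu>\<^sup>2)"
    and Aeq: "\<And>\<theta>. (\<Sum>k<M. \<Sum>l<M. w k l * cos (real k * \<theta> - real l * \<theta>))
        = (\<Sum>k<M. w k k) + (\<Sum>j\<in>{1..<M}. A j * cos (real j * \<theta>))"
    using sum_by_difference[of M w "3 * \<mu>\<^sup>2"] wb by blast
  have P: "(\<Sum>k<M. \<Sum>l<M. w k l * cos (real k * \<theta> - real l * \<theta>))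
     = (lam - (2 - 2 * cos \<theta>)) * (cmod (\<Sum>k<M. of_real (parab M k) * cis (real k * \<theta>)))\<^sup>2" for \<theta>
  proof -
    have pw: "cis \<theta> ^ k = cis (real k * \<theta>)" for k by (rule Complex.DeMoivre)
    have "(\<Sum>k<M. \<Sum>l<M. w k l * cos (real k * \<theta> - real l * \<theta>))
      = lam * (cmod (\<Sum>k<M. of_real (parab M k) * cis (real k * \<theta>)))\<^sup>2
        - (cmod (\<Sum>k<M. of_real (parab_diff M k) * cis (real k * \<theta>)))\<^sup>2"
      unfolding cmod_trig_sum_squared[OF finite_lessThan] w_def sum_distrib_left sum_subtractf[symmetric]
      by (simp only: left_diff_distrib mult.assoc)
    \<comment> \<open>Multiplying by \<open>cis \<theta>\<close> does not change the modulus and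
      produces the left side of \<open>parab_diff_generating\<close>.\<close>
    also have "cmod (\<Sum>k<M. of_real (parab_diff M k) * cis (real k * \<theta>))
      = cmod (cis \<theta> * (\<Sum>k<M. of_real (parab_diff M k) * cis \<theta> ^ k))"
      by (simp add: norm_mult pw)
    also have "\<dots> = cmod (1 - cis \<theta>) * cmod (\<Sum>k<M. of_real (parab M k) * cis (real k * \<theta>))"
      unfolding parab_diff_generating norm_mult by (simp only: pw)
    finally show ?thesis
      by (simp only: power_mult_distrib norm_one_minus_cis_squared left_diff_distrib)
  qed
  show ?thesis
  proof (rule that[of "\<lambda>j. A j / H"])
    fix j
    have "\<bar>A j\<bar> \<le> 6 * \<mu>^3" using A[of j] by (simp add: \<mu>_def eval_nat_numeral)
    also have "\<dots> \<le> 24 * H" using H by simp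
    finally show "\<bar>A j / H\<bar> \<le> 24" using Hpos by (simp add: divide_simps)
  next
    fix t assume t: "dist_int t \<ge> 2 / real M"
    have "5 * (2 / \<mu>)\<^sup>2 \<le> 2 - 2 * cos (2 * pi * t)"
      using t by (intro cos_two_pi_dist_int) (auto simp: \<mu>_def)
    moreover have "5 * (2 / \<mu>)\<^sup>2 \<ge> lam"
      using \<mu> pos by (simp add: lam_def power_divide divide_simps)
    ultimately have "lam - (2 - 2 * cos (2 * pi * t)) \<le> 0" by linarith
    then have "H + (\<Sum>j\<in>{1..<M}. A j * cos (real j * (2 * pi * t))) \<le> 0"
      unfolding Aeq[of "2 * pi * t", unfolded P diag, symmetric]
      by (rule mult_nonpos_nonneg) simp
    then have "(H + (\<Sum>j\<in>{1..<M}. A j * cos (real j * (2 * pi * t)))) / H \<le> 0"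
      using Hpos by (simp add: divide_nonpos_pos)
    then show "1 + (\<Sum>j\<in>{1..<M}. A j / H * cos (real j * (2 * pi * t))) \<le> 0"
      using Hpos by (simp add: add_divide_distrib sum_divide_distrib)
  qed
qed

section \<open>Mean squares of trigonometric sums\<close>

lemma sum_inverse_squares_le: "(\<Sum>n=1..R. 1 / (real n)\<^sup>2) \<le> 2"
proof -
  \<comment> \<open>The sharper bound makes the induction work: each new term is at most
    \<open>1/n - 1/(n+1)\<close>.\<close>
  have "(\<Sum>n=1..R. 1 / (real n)\<^sup>2) \<le> 2 - 1 / real R" if "R \<ge> 1" for R
    using that
  proof (induction R rule: dec_induct)
    case (step n)
    then have n: "real n \<ge> 1" by simp
    have "1 / (real n + 1)\<^sup>2 \<le> 1 / (real n * (real n + 1))"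
      using n by (intro divide_left_mono) (auto simp: power2_eq_square)
    also have "\<dots> = 1 / real n - 1 / (real n + 1)" using n by (simp add: field_simps)
    finally show ?case using step by (simp add: add.commute)
  qed simp
  from this[of R] show ?thesis
  proof (cases "R = 0")
    case False
    then have "1 / real R \<ge> 0" "R \<ge> 1" by simp_all
    then show ?thesis using \<open>R \<ge> 1 \<Longrightarrow> _\<close> by linarith
  qed simp
qed

text \<open>
  Up to the factor \<open>T\<^sup>2\<close>, this dominates the Fourier transform of the tent
  \<open>T - \<bar>\<alpha>\<bar>\<close> at \<open>y - z\<close> for all \<open>y\<close>, \<open>z\<close> whose integer parts differ by \<open>n\<close>.
\<close>

definition decay :: "int \<Rightarrow> real" where
  "decay n = (if n = 0 then 1 else 4 / (of_int n)\<^sup>2)"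

lemma decay_nonneg: "decay n \<ge> 0" and decay_minus: "decay (- n) = decay n"
  by (auto simp: decay_def)

text \<open>The 17 is 1 from the zero difference plus 8 from each sign. It depends neither on
  \<open>p\<close> nor on \<open>Q\<close>.\<close>

lemma sum_decay_le:
  assumes "finite Q"
  shows "(\<Sum>q\<in>Q. decay (p - q)) \<le> 17"
proof -
  define Q' where "Q' = (\<lambda>q. p - q) ` Q"
  define R where "R = Max (insert 0 ((\<lambda>n. nat \<bar>n\<bar>) ` Q'))"
  have fin: "finite Q'" using assms by (simp add: Q'_def)
  have R: "nat \<bar>n\<bar> \<le> R" if "n \<in> Q'" for n
    unfolding R_def using that fin by (intro Max_ge) auto
  have sub: "Q' \<subseteq> insert 0 (int ` {1..R} \<union> (\<lambda>n. - int n) ` {1..R})"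
  proof
    fix n assume "n \<in> Q'"
    from R[OF this] show "n \<in> insert 0 (int ` {1..R} \<union> (\<lambda>n. - int n) ` {1..R})"
      by (cases n rule: int_cases2) auto
  qed
  have s: "(\<Sum>n=1..R. decay (int n)) \<le> 8"
  proof -
    have "(\<Sum>n=1..R. decay (int n)) = (\<Sum>n=1..R. 4 * (1 / (real n)\<^sup>2))"
      by (intro sum.cong) (auto simp: decay_def)
    then show ?thesis using sum_inverse_squares_le[of R] by (simp only: sum_distrib_left[symmetric])
  qed
  have "(\<Sum>q\<in>Q. decay (p - q)) = (\<Sum>n\<in>Q'. decay n)"
    unfolding Q'_def by (subst sum.reindex) (auto simp: inj_on_def)
  also have "\<dots> \<le> (\<Sum>n\<in>insert 0 (int ` {1..R} \<union> (\<lambda>n. - int n) ` {1..R}). decay n)"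
    using sub by (intro sum_mono2) (auto simp: decay_nonneg)
  also have "\<dots> = 1 + (\<Sum>n\<in>int ` {1..R} \<union> (\<lambda>n. - int n) ` {1..R}. decay n)"
    by (subst sum.insert) (auto simp: decay_def)
  also have "(\<Sum>n\<in>int ` {1..R} \<union> (\<lambda>n. - int n) ` {1..R}. decay n)
      = (\<Sum>n=1..R. decay (int n)) + (\<Sum>n=1..R. decay (int n))"
    by (subst sum.union_disjoint) (auto simp: sum.reindex inj_on_def decay_minus)
  finally show ?thesis using s by simp
qed

text \<open>Rewrites a double sum over indices as a quadratic form in the multiplicities of the
  values of \<open>p\<close>, the shape needed for the Schur-type bound below.\<close>

lemma sum_over_fibres:
  fixes K :: "'b \<Rightarrow> 'b \<Rightarrow> real"
  assumes "finite I"
  shows "(\<Sum>i\<in>I. \<Sum>k\<in>I. K (p i) (p k))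
     = (\<Sum>u\<in>p`I. \<Sum>v\<in>p`I. real (card {i\<in>I. p i = u}) * real (card {i\<in>I. p i = v}) * K u v)"
proof -
  have *: "(\<Sum>i\<in>I. G (p i)) = (\<Sum>u\<in>p`I. real (card {i\<in>I. p i = u}) * G u)" for G :: "'b \<Rightarrow> real"
    using sum.image_gen[OF assms, of "\<lambda>i. G (p i)" p] by simp
  have "(\<Sum>i\<in>I. \<Sum>k\<in>I. K (p i) (p k))
      = (\<Sum>i\<in>I. (\<lambda>u. \<Sum>v\<in>p`I. real (card {i\<in>I. p i = v}) * K u v) (p i))"
    using *[of "K _"] by simp
  also have "\<dots> = (\<Sum>u\<in>p`I. real (card {i\<in>I. p i = u}) * (\<Sum>v\<in>p`I. real (card {i\<in>I. p i = v}) * K u v))"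
    by (rule *)
  finally show ?thesis by (simp add: sum_distrib_left mult.assoc)
qed

text \<open>Schur's test: with fibre sizes \<open>c\<close>, use
  \<open>c u * c v <= ((c u)^2 + (c v)^2) / 2\<close>, the symmetry of \<open>decay\<close> and its
  row sums. What remains is the sum of \<open>(c u)^2\<close>, which counts the pairs with equal
  \<open>p\<close>.\<close>

lemma sum_decay_pairs_le:
  fixes p :: "'i \<Rightarrow> int"
  assumes "finite I"
  shows "(\<Sum>i\<in>I. \<Sum>k\<in>I. decay (p i - p k)) \<le> 17 * (\<Sum>i\<in>I. \<Sum>k\<in>I. if p i = p k then 1 else 0)"
proof -
  define P where "P = p ` I"
  define c where "c = (\<lambda>u. real (card {i\<in>I. p i = u}))"
  have fP: "finite P" using assms by (simp add: P_def)
  have am: "c u * c v * decay (u - v) \<le> ((c u)\<^sup>2 * decay (u - v) + (c v)\<^sup>2 * decay (u - v)) / 2" for u v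
  proof -
    have "c u * c v \<le> ((c u)\<^sup>2 + (c v)\<^sup>2) / 2"
      using sum_squares_bound[of "c u" "c v"] by simp
    then have "c u * c v * decay (u - v) \<le> ((c u)\<^sup>2 + (c v)\<^sup>2) / 2 * decay (u - v)"
      by (intro mult_right_mono decay_nonneg)
    then show ?thesis by (simp add: algebra_simps)
  qed
  have "(\<Sum>i\<in>I. \<Sum>k\<in>I. decay (p i - p k)) = (\<Sum>u\<in>P. \<Sum>v\<in>P. c u * c v * decay (u - v))"
    using sum_over_fibres[OF assms, of "\<lambda>u v. decay (u - v)" p] by (simp add: P_def c_def)
  also have "\<dots> \<le> (\<Sum>u\<in>P. \<Sum>v\<in>P. ((c u)\<^sup>2 * decay (u - v) + (c v)\<^sup>2 * decay (u - v)) / 2)"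
    by (intro sum_mono am)
  also have "\<dots> = ((\<Sum>u\<in>P. \<Sum>v\<in>P. (c u)\<^sup>2 * decay (u - v)) + (\<Sum>u\<in>P. \<Sum>v\<in>P. (c v)\<^sup>2 * decay (u - v))) / 2"
    by (simp add: sum.distrib sum_divide_distrib[symmetric])
  also have "(\<Sum>u\<in>P. \<Sum>v\<in>P. (c v)\<^sup>2 * decay (u - v)) = (\<Sum>u\<in>P. \<Sum>v\<in>P. (c u)\<^sup>2 * decay (u - v))"
    by (subst sum.swap, intro sum.cong refl arg_cong2[of _ _ _ _ "(*)"])
       (metis decay_minus minus_diff_eq)
  also have "(S + S) / 2 = S" for S :: real by simp
  also have "(\<Sum>u\<in>P. \<Sum>v\<in>P. (c u)\<^sup>2 * decay (u - v)) = (\<Sum>u\<in>P. (c u)\<^sup>2 * (\<Sum>v\<in>P. decay (u - v)))"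
    by (simp add: sum_distrib_left)
  also have "\<dots> \<le> (\<Sum>u\<in>P. (c u)\<^sup>2 * 17)"
    by (intro sum_mono mult_left_mono sum_decay_le fP) auto
  also have "\<dots> = 17 * (\<Sum>u\<in>P. \<Sum>v\<in>P. c u * c v * (if u = v then 1 else 0))"
    using fP by (simp add: sum_distrib_left power2_eq_square if_distrib sum.delta' cong: if_cong)
       (simp add: mult_ac)
  also have "(\<Sum>u\<in>P. \<Sum>v\<in>P. c u * c v * (if u = v then 1 else 0)) = (\<Sum>i\<in>I. \<Sum>k\<in>I. if p i = p k then 1 else 0)"
    using sum_over_fibres[OF assms, of "\<lambda>u v. if u = v then 1 else 0" p] by (simp add: P_def c_def)
  finally show ?thesis .
qed

section \<open>Fourier transform of the tent weight\<close>

lemma has_integral_tent_cos: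
  fixes u T :: real
  assumes "u \<noteq> 0" and "T \<ge> 0"
  shows "((\<lambda>\<alpha>. (T - \<bar>\<alpha>\<bar>) * cos (u * \<alpha>)) has_integral (2 * (1 - cos (u * T)) / u\<^sup>2)) {-T..T}"
proof -
  have 1: "((\<lambda>\<alpha>. (T - \<bar>\<alpha>\<bar>) * cos (u * \<alpha>)) has_integral
     (((T - T) * sin (u * T) / u - cos (u * T) / u\<^sup>2) - ((T - 0) * sin (u * 0) / u - cos (u * 0) / u\<^sup>2))) {0..T}"
    using assms
    by (intro fundamental_theorem_of_calculus)
       (auto intro!: derivative_eq_intros simp: has_real_derivative_iff_has_vector_derivative[symmetric] field_simps power2_eq_square)
  have 2: "((\<lambda>\<alpha>. (T - \<bar>\<alpha>\<bar>) * cos (u * \<alpha>)) has_integral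
     (((T + 0) * sin (u * 0) / u + cos (u * 0) / u\<^sup>2) - ((T + (-T)) * sin (u * (-T)) / u + cos (u * (-T)) / u\<^sup>2))) {-T..0}"
    using assms
    by (intro fundamental_theorem_of_calculus)
       (auto intro!: derivative_eq_intros simp: has_real_derivative_iff_has_vector_derivative[symmetric] field_simps power2_eq_square)
  have "((\<lambda>\<alpha>. (T - \<bar>\<alpha>\<bar>) * cos (u * \<alpha>)) has_integral
     ((((T + 0) * sin (u * 0) / u + cos (u * 0) / u\<^sup>2) - ((T + (-T)) * sin (u * (-T)) / u + cos (u * (-T)) / u\<^sup>2))
     + (((T - T) * sin (u * T) / u - cos (u * T) / u\<^sup>2) - ((T - 0) * sin (u * 0) / u - cos (u * 0) / u\<^sup>2)))) {-T..T}"
    using assms by (intro has_integral_combine[OF _ _ 2 1]) auto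
  then show ?thesis by (simp add: diff_divide_distrib)
qed

lemma has_integral_tent:
  assumes "(T::real) \<ge> 0"
  shows "((\<lambda>\<alpha>. T - \<bar>\<alpha>\<bar>) has_integral T\<^sup>2) {-T..T}"
proof -
  have 1: "((\<lambda>\<alpha>. T - \<bar>\<alpha>\<bar>) has_integral ((T * T - T\<^sup>2 / 2) - (T * 0 - 0\<^sup>2 / 2))) {0..T}"
    using assms
    by (intro fundamental_theorem_of_calculus)
       (auto intro!: derivative_eq_intros simp: has_real_derivative_iff_has_vector_derivative[symmetric])
  have 2: "((\<lambda>\<alpha>. T - \<bar>\<alpha>\<bar>) has_integral ((T * 0 + 0\<^sup>2 / 2) - (T * (-T) + (-T)\<^sup>2 / 2))) {-T..0}"
    using assms
    by (intro fundamental_theorem_of_calculus)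
       (auto intro!: derivative_eq_intros simp: has_real_derivative_iff_has_vector_derivative[symmetric])
  have "((\<lambda>\<alpha>. T - \<bar>\<alpha>\<bar>) has_integral
    (((T * 0 + 0\<^sup>2 / 2) - (T * (-T) + (-T)\<^sup>2 / 2)) + ((T * T - T\<^sup>2 / 2) - (T * 0 - 0\<^sup>2 / 2)))) {-T..T}"
    using assms by (intro has_integral_combine[OF _ _ 2 1]) auto
  then show ?thesis by (simp add: power2_eq_square)
qed

text \<open>The tent weight is used because its transform decays like \<open>1 / u^2\<close>, which
  is summable over the integers; a sharp cutoff would give only \<open>1 / u\<close>.\<close>

lemma tent_fourier_decay:
  fixes T y z :: real
  assumes "T \<ge> 1"
  obtains J where "((\<lambda>\<alpha>. (T - \<bar>\<alpha>\<bar>) * cos (2 * pi * y * \<alpha> - 2 * pi * z * \<alpha>)) has_integral J) {-T..T}"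
    "\<bar>J\<bar> \<le> T\<^sup>2 * decay (\<lfloor>y\<rfloor> - \<lfloor>z\<rfloor>)"
proof (cases "y = z")
  case True
  then show ?thesis
    using has_integral_tent[of T] assms by (intro that[of "T\<^sup>2"]) (auto simp: decay_def)
next
  case False
  define u where "u = 2 * pi * (y - z)"
  define J where "J = 2 * (1 - cos (u * T)) / u\<^sup>2"
  have u: "u \<noteq> 0" using False by (simp add: u_def)
  have J0: "J \<ge> 0" by (simp add: J_def)
  show ?thesis
  proof (rule that[of J])
    show "((\<lambda>\<alpha>. (T - \<bar>\<alpha>\<bar>) * cos (2 * pi * y * \<alpha> - 2 * pi * z * \<alpha>)) has_integral J) {-T..T}"
      using has_integral_tent_cos[OF u, of T] assms by (simp add: J_def u_def algebra_simps)
    define d where "d = \<lfloor>y\<rfloor> - \<lfloor>z\<rfloor>"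
    have "J \<le> T\<^sup>2 * decay d"
    \<comment> \<open>Integer parts differing by at most 1 allow \<open>y\<close> and
      \<open>z\<close> to be arbitrarily close, so only \<open>J <= T^2\<close> is available, from
      \<open>|sin v| <= |v|\<close>. Otherwise \<open>|y - z| >= |d| - 1 >= |d| / 2\<close>.\<close>
    proof (cases "\<bar>d\<bar> \<le> 1")
      case True
      then have "d = 0 \<or> d = 1 \<or> d = -1" by auto
      then have "decay d \<ge> 1" by (auto simp: decay_def)
      have "1 - cos (u * T) = 2 * (sin (u * T / 2))\<^sup>2"
        using cos_double_sin[of "u * T / 2"] by simp
      moreover have "\<bar>sin (u * T / 2)\<bar>\<^sup>2 \<le> \<bar>u * T / 2\<bar>\<^sup>2"
        by (intro power_mono abs_sin_x_le_abs_x) auto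
      ultimately have "2 * (1 - cos (u * T)) \<le> u\<^sup>2 * T\<^sup>2" by (simp add: power_mult_distrib power_divide)
      then have "J \<le> T\<^sup>2 * 1" using u by (simp add: J_def divide_simps mult.commute)
      also have "\<dots> \<le> T\<^sup>2 * decay d" using \<open>decay d \<ge> 1\<close> by (intro mult_left_mono) auto
      finally show ?thesis .
    next
      case d: False
      have dd: "\<bar>real_of_int d\<bar> \<ge> 2" using d by linarith
      have "\<bar>y - z\<bar> \<ge> \<bar>real_of_int d\<bar> - 1" unfolding d_def by linarith
      then have yz: "\<bar>y - z\<bar> \<ge> \<bar>real_of_int d\<bar> / 2" using dd by linarith
      have "\<bar>u\<bar> = 2 * pi * \<bar>y - z\<bar>" by (simp add: u_def abs_mult)
      also have "\<dots> \<ge> 2 * pi * (\<bar>real_of_int d\<bar> / 2)" using yz by (intro mult_left_mono) auto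
      finally have "\<bar>u\<bar> \<ge> pi * \<bar>real_of_int d\<bar>" by simp
      moreover have "pi * \<bar>real_of_int d\<bar> \<ge> 1 * \<bar>real_of_int d\<bar>"
        using pi_gt3 by (intro mult_right_mono) auto
      ultimately have "\<bar>u\<bar>\<^sup>2 \<ge> \<bar>real_of_int d\<bar>\<^sup>2" by (intro power_mono) auto
      then have u2: "u\<^sup>2 \<ge> (real_of_int d)\<^sup>2" by simp
      have "2 * (1 - q) \<le> 4" if "- 1 \<le> q" for q :: real using that by simp
      from this[OF cos_ge_minus_one] have "J \<le> 4 / u\<^sup>2" unfolding J_def by (intro divide_right_mono) auto
      also have "\<dots> \<le> 4 / (real_of_int d)\<^sup>2" using u2 dd u by (intro divide_left_mono mult_pos_pos) auto
      also have "\<dots> = 1 * decay d" using d by (auto simp: decay_def)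
      also have "\<dots> \<le> T\<^sup>2 * decay d" using assms by (intro mult_right_mono decay_nonneg) simp
      finally show ?thesis .
    qed
    then show "\<bar>J\<bar> \<le> T\<^sup>2 * decay (\<lfloor>y\<rfloor> - \<lfloor>z\<rfloor>)" using J0 by (simp add: d_def)
  qed
qed

text \<open>Expanding the square leaves one tent integral per pair of frequencies. The decay bound
  reduces these to pairs with equal integer parts, and such frequencies are less than 1
  apart.\<close>

lemma mean_square_le:
  fixes a y :: "'i \<Rightarrow> real" and T :: real
  assumes "finite I" and "T \<ge> 1" and a: "\<And>i. i \<in> I \<Longrightarrow> \<bar>a i\<bar> \<le> b"
  obtains V where
    "((\<lambda>\<alpha>. (T - \<bar>\<alpha>\<bar>) * (cmod (\<Sum>i\<in>I. of_real (a i) * cis (2 * pi * y i * \<alpha>)))\<^sup>2) has_integral V) {-T..T}"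
    "V \<le> 17 * T\<^sup>2 * b\<^sup>2 * (\<Sum>i\<in>I. \<Sum>k\<in>I. if \<bar>y i - y k\<bar> < 1 then 1 else 0)"
proof (cases "I = {}")
  case True
  then show ?thesis by (intro that[of 0]) auto
next
  case False
  then have b: "b \<ge> 0" using a by force
  define J where "J = (\<lambda>i k. integral {-T..T} (\<lambda>\<alpha>. (T - \<bar>\<alpha>\<bar>) * cos (2 * pi * y i * \<alpha> - 2 * pi * y k * \<alpha>)))"
  have J: "((\<lambda>\<alpha>. (T - \<bar>\<alpha>\<bar>) * cos (2 * pi * y i * \<alpha> - 2 * pi * y k * \<alpha>)) has_integral J i k) {-T..T}"
    and J_le: "\<bar>J i k\<bar> \<le> T\<^sup>2 * decay (\<lfloor>y i\<rfloor> - \<lfloor>y k\<rfloor>)" for i k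
  proof -
    obtain V where V: "((\<lambda>\<alpha>. (T - \<bar>\<alpha>\<bar>) * cos (2 * pi * y i * \<alpha> - 2 * pi * y k * \<alpha>)) has_integral V) {-T..T}"
      "\<bar>V\<bar> \<le> T\<^sup>2 * decay (\<lfloor>y i\<rfloor> - \<lfloor>y k\<rfloor>)"
      by (rule tent_fourier_decay[OF assms(2)])
    then have "J i k = V" unfolding J_def by (intro integral_unique)
    with V show "((\<lambda>\<alpha>. (T - \<bar>\<alpha>\<bar>) * cos (2 * pi * y i * \<alpha> - 2 * pi * y k * \<alpha>)) has_integral J i k) {-T..T}"
      and "\<bar>J i k\<bar> \<le> T\<^sup>2 * decay (\<lfloor>y i\<rfloor> - \<lfloor>y k\<rfloor>)" by simp_all
  qed
  show ?thesis
  proof (rule that)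
    have "((\<lambda>\<alpha>. \<Sum>i\<in>I. \<Sum>k\<in>I. (a i * a k) * ((T - \<bar>\<alpha>\<bar>) * cos (2 * pi * y i * \<alpha> - 2 * pi * y k * \<alpha>)))
       has_integral (\<Sum>i\<in>I. \<Sum>k\<in>I. (a i * a k) * J i k)) {-T..T}"
      by (intro has_integral_sum assms has_integral_mult_right J)
    then show "((\<lambda>\<alpha>. (T - \<bar>\<alpha>\<bar>) * (cmod (\<Sum>i\<in>I. of_real (a i) * cis (2 * pi * y i * \<alpha>)))\<^sup>2)
       has_integral (\<Sum>i\<in>I. \<Sum>k\<in>I. (a i * a k) * J i k)) {-T..T}"
      by (simp add: cmod_trig_sum_squared assms sum_distrib_left mult_ac)
    have "(a i * a k) * J i k \<le> b\<^sup>2 * (T\<^sup>2 * decay (\<lfloor>y i\<rfloor> - \<lfloor>y k\<rfloor>))" if "i \<in> I" "k \<in> I" for i k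
    proof -
      have "(a i * a k) * J i k \<le> \<bar>a i * a k\<bar> * \<bar>J i k\<bar>" by (metis abs_ge_self abs_mult)
      also have "\<dots> \<le> b\<^sup>2 * (T\<^sup>2 * decay (\<lfloor>y i\<rfloor> - \<lfloor>y k\<rfloor>))"
        unfolding abs_mult power2_eq_square[of b]
        using a that b J_le by (intro mult_mono) auto
      finally show ?thesis .
    qed
    then have "(\<Sum>i\<in>I. \<Sum>k\<in>I. (a i * a k) * J i k) \<le> (\<Sum>i\<in>I. \<Sum>k\<in>I. b\<^sup>2 * (T\<^sup>2 * decay (\<lfloor>y i\<rfloor> - \<lfloor>y k\<rfloor>)))"
      by (intro sum_mono) auto
    also have "\<dots> = b\<^sup>2 * T\<^sup>2 * (\<Sum>i\<in>I. \<Sum>k\<in>I. decay (\<lfloor>y i\<rfloor> - \<lfloor>y k\<rfloor>))"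
      by (simp add: sum_distrib_left mult.assoc)
    also have "\<dots> \<le> b\<^sup>2 * T\<^sup>2 * (17 * (\<Sum>i\<in>I. \<Sum>k\<in>I. if \<lfloor>y i\<rfloor> = \<lfloor>y k\<rfloor> then 1 else 0))"
      by (intro mult_left_mono sum_decay_pairs_le assms) auto
    also have "\<dots> \<le> b\<^sup>2 * T\<^sup>2 * (17 * (\<Sum>i\<in>I. \<Sum>k\<in>I. if \<bar>y i - y k\<bar> < 1 then 1 else 0))"
    proof (intro mult_left_mono sum_mono)
      fix i k
      show "(if \<lfloor>y i\<rfloor> = \<lfloor>y k\<rfloor> then 1 else 0) \<le> (if \<bar>y i - y k\<bar> < 1 then 1 else 0 :: real)"
      proof (cases "\<lfloor>y i\<rfloor> = \<lfloor>y k\<rfloor>")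
        case True
        then have "\<bar>y i - y k\<bar> < 1" by linarith
        then show ?thesis by simp
      qed simp
    qed auto
    finally show "(\<Sum>i\<in>I. \<Sum>k\<in>I. (a i * a k) * J i k)
      \<le> 17 * T\<^sup>2 * b\<^sup>2 * (\<Sum>i\<in>I. \<Sum>k\<in>I. if \<bar>y i - y k\<bar> < 1 then 1 else 0)"
      by (simp add: mult_ac)
  qed
qed

text \<open>Chebyshev's inequality for the mean square: the tent is at least \<open>T / 2\<close> on
  \<open>{-T/2..T/2}\<close>, which turns 17 into 34, and the cosine sum is the real part of the
  exponential sum.\<close>

lemma measure_large_values_le:
  fixes a y :: "'i \<Rightarrow> real" and T s :: real
  assumes "finite I" and T: "T \<ge> 1" and "\<And>i. i \<in> I \<Longrightarrow> \<bar>a i\<bar> \<le> b" and s: "s > 0"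
  defines "S \<equiv> {\<alpha>\<in>{-T/2..T/2}. \<bar>\<Sum>i\<in>I. a i * cos (2 * pi * y i * \<alpha>)\<bar> \<ge> s}"
  shows "S \<in> lmeasurable"
    and "measure lebesgue S * s\<^sup>2 \<le> 34 * T * b\<^sup>2 * (\<Sum>i\<in>I. \<Sum>k\<in>I. if \<bar>y i - y k\<bar> < 1 then 1 else 0)"
proof -
  have "closed {\<alpha>. s \<le> \<bar>\<Sum>i\<in>I. a i * cos (2 * pi * y i * \<alpha>)\<bar>}"
    by (intro closed_Collect_le continuous_intros)
  then have "compact ({-T/2..T/2} \<inter> {\<alpha>. s \<le> \<bar>\<Sum>i\<in>I. a i * cos (2 * pi * y i * \<alpha>)\<bar>})"
    by (rule compact_Int_closed[OF compact_Icc])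
  moreover have "S = {-T/2..T/2} \<inter> {\<alpha>. s \<le> \<bar>\<Sum>i\<in>I. a i * cos (2 * pi * y i * \<alpha>)\<bar>}"
    unfolding S_def by blast
  ultimately have "compact S" by simp
  then show lm: "S \<in> lmeasurable" by (rule lmeasurable_compact)
  define E where "E = (\<lambda>\<alpha>. cmod (\<Sum>i\<in>I. of_real (a i) * cis (2 * pi * y i * \<alpha>)))"
  obtain V where V: "((\<lambda>\<alpha>. (T - \<bar>\<alpha>\<bar>) * (E \<alpha>)\<^sup>2) has_integral V) {-T..T}"
    and V_le: "V \<le> 17 * T\<^sup>2 * b\<^sup>2 * (\<Sum>i\<in>I. \<Sum>k\<in>I. if \<bar>y i - y k\<bar> < 1 then 1 else 0)"
    unfolding E_def by (rule mean_square_le[OF assms(1) T, of a b y]) (use assms(3) in blast)+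
  have "(indicator S has_integral measure lebesgue S) UNIV"
    using lm by (simp add: lmeasurable_iff_has_integral)
  then have ind: "((\<lambda>\<alpha>. T / 2 * s\<^sup>2 * indicator S \<alpha>) has_integral T / 2 * s\<^sup>2 * measure lebesgue S) UNIV"
    by (rule has_integral_mult_right)
  have V': "((\<lambda>\<alpha>. if \<alpha> \<in> {-T..T} then (T - \<bar>\<alpha>\<bar>) * (E \<alpha>)\<^sup>2 else 0) has_integral V) UNIV"
    using V by (simp only: has_integral_restrict_UNIV)
  have "T / 2 * s\<^sup>2 * measure lebesgue S \<le> V"
  proof (rule has_integral_le[OF ind V'])
    fix \<alpha> :: real
    show "T / 2 * s\<^sup>2 * indicator S \<alpha> \<le> (if \<alpha> \<in> {-T..T} then (T - \<bar>\<alpha>\<bar>) * (E \<alpha>)\<^sup>2 else 0)"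
    proof (cases "\<alpha> \<in> S")
      case True
      then have \<alpha>: "\<bar>\<alpha>\<bar> \<le> T / 2" "s \<le> \<bar>\<Sum>i\<in>I. a i * cos (2 * pi * y i * \<alpha>)\<bar>"
        by (auto simp: S_def)
      note \<alpha>(2)
      also have "\<bar>\<Sum>i\<in>I. a i * cos (2 * pi * y i * \<alpha>)\<bar> = \<bar>Re (\<Sum>i\<in>I. of_real (a i) * cis (2 * pi * y i * \<alpha>))\<bar>"
        by simp
      also have "\<dots> \<le> E \<alpha>" unfolding E_def by (rule abs_Re_le_cmod)
      finally have "s\<^sup>2 \<le> (E \<alpha>)\<^sup>2" using s by (intro power_mono) auto
      then have "T / 2 * s\<^sup>2 \<le> (T - \<bar>\<alpha>\<bar>) * (E \<alpha>)\<^sup>2"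
        using \<alpha>(1) T by (intro mult_mono) auto
      then show ?thesis using True \<alpha>(1) T by auto
    qed auto
  qed
  with V_le have "T / 2 * s\<^sup>2 * measure lebesgue S
      \<le> 17 * T\<^sup>2 * b\<^sup>2 * (\<Sum>i\<in>I. \<Sum>k\<in>I. if \<bar>y i - y k\<bar> < 1 then 1 else 0)" by linarith
  then have "T / 2 * (measure lebesgue S * s\<^sup>2)
      \<le> T / 2 * (34 * T * b\<^sup>2 * (\<Sum>i\<in>I. \<Sum>k\<in>I. if \<bar>y i - y k\<bar> < 1 then 1 else 0))"
    by (simp add: power2_eq_square mult_ac)
  then show "measure lebesgue S * s\<^sup>2 \<le> 34 * T * b\<^sup>2 * (\<Sum>i\<in>I. \<Sum>k\<in>I. if \<bar>y i - y k\<bar> < 1 then 1 else 0)"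
    using T by (simp only: mult_le_cancel_left_pos half_gt_zero_iff)
qed

section \<open>Exceptional sets\<close>

lemma finite_distances:
  "finite {dist_int (\<alpha> * x m - \<alpha> * x n) | m n. m \<in> {1..N} \<and> n \<in> {1..N} \<and> m \<noteq> (n :: nat)}"
  by (rule finite_subset[of _ "(\<lambda>(m,n). dist_int (\<alpha> * x m - \<alpha> * x n)) ` ({1..N} \<times> {1..N})"]) auto

lemma delta_min_le:
  assumes "m \<in> {1..N}" "n \<in> {1..N}" "m \<noteq> n"
  shows "delta_min \<alpha> x N \<le> dist_int (\<alpha> * x m - \<alpha> * x n)"
  unfolding delta_min_def using assms by (intro Min_le finite_distances) blast

lemma delta_min_antimono:
  assumes "2 \<le> M" "M \<le> N"
  shows "delta_min \<alpha> x N \<le> delta_min \<alpha> x M"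
  unfolding delta_min_def
proof (rule Min_antimono)
  show "{dist_int (\<alpha> * x m - \<alpha> * x n) | m n. m \<in> {1..M} \<and> n \<in> {1..M} \<and> m \<noteq> n} \<noteq> {}"
  proof -
    have "1 \<in> {1..M} \<and> 2 \<in> {1..M} \<and> (1::nat) \<noteq> 2" using assms by auto
    then show ?thesis by blast
  qed
  have "{1..M} \<subseteq> {1..N}" using assms by auto
  then show "{dist_int (\<alpha> * x m - \<alpha> * x n) | m n. m \<in> {1..M} \<and> n \<in> {1..M} \<and> m \<noteq> n}
     \<subseteq> {dist_int (\<alpha> * x m - \<alpha> * x n) | m n. m \<in> {1..N} \<and> n \<in> {1..N} \<and> m \<noteq> n}" by blast
qed (rule finite_distances)

lemma dist_int_le_1: "dist_int t \<le> 1"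
proof -
  have "dist_int t \<le> \<bar>t - of_int \<lfloor>t\<rfloor>\<bar>"
    unfolding dist_int_def by (rule cINF_lower) (auto intro!: bdd_belowI[of _ 0])
  then show ?thesis by linarith
qed

section \<open>From a large minimum to the counting sum\<close>

definition off_diag :: "nat \<Rightarrow> (nat \<times> nat) set" where
  "off_diag N = {p \<in> {1..N} \<times> {1..N}. fst p \<noteq> snd p}"

lemma finite_off_diag: "finite (off_diag N)"
  by (simp add: off_diag_def)

lemma card_off_diag: "real (card (off_diag N)) = real N * (real N - 1)"
proof -
  have "off_diag N = {1..N} \<times> {1..N} - (\<lambda>n. (n, n)) ` {1..N}" by (auto simp: off_diag_def)
  then have "card (off_diag N) = N * N - N"
    by (simp add: card_Diff_subset card_image inj_on_def image_subset_iff)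
  moreover have "N \<le> N * N" by simp
  ultimately show ?thesis by (simp add: of_nat_diff algebra_simps)
qed

text \<open>Summing the minorant inequality over all off-diagonal pairs, the constant terms
  contribute \<open>N * (N - 1)\<close>, which the cosine terms must cancel.\<close>

lemma delta_min_large_imp:
  fixes a :: "nat \<Rightarrow> real"
  assumes a: "\<And>t. dist_int t \<ge> 2 / real M \<Longrightarrow> 1 + (\<Sum>j\<in>{1..<M}. a j * cos (real j * (2 * pi * t))) \<le> 0"
    and "delta_min \<alpha> x N \<ge> 2 / real M"
  shows "real N * (real N - 1)
    \<le> \<bar>\<Sum>(j, m, n)\<in>{1..<M} \<times> off_diag N. a j * cos (2 * pi * (real j * (x m - x n)) * \<alpha>)\<bar>"
proof -
  have "1 + (\<Sum>j\<in>{1..<M}. a j * cos (real j * (2 * pi * (\<alpha> * x (fst p) - \<alpha> * x (snd p))))) \<le> 0"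
    if "p \<in> off_diag N" for p
    using that assms(2) delta_min_le[of "fst p" N "snd p" \<alpha> x]
    by (intro a) (auto simp: off_diag_def)
  then have "(\<Sum>p\<in>off_diag N. 1 + (\<Sum>j\<in>{1..<M}. a j * cos (real j * (2 * pi * (\<alpha> * x (fst p) - \<alpha> * x (snd p)))))) \<le> 0"
    by (rule sum_nonpos)
  then have "real (card (off_diag N)) + (\<Sum>p\<in>off_diag N. \<Sum>j\<in>{1..<M}. a j * cos (real j * (2 * pi * (\<alpha> * x (fst p) - \<alpha> * x (snd p))))) \<le> 0"
    by (simp add: sum.distrib)
  also have "(\<Sum>p\<in>off_diag N. \<Sum>j\<in>{1..<M}. a j * cos (real j * (2 * pi * (\<alpha> * x (fst p) - \<alpha> * x (snd p)))))
    = (\<Sum>j\<in>{1..<M}. \<Sum>p\<in>off_diag N. a j * cos (2 * pi * (real j * (x (fst p) - x (snd p))) * \<alpha>))"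
    by (subst sum.swap) (simp add: algebra_simps)
  also have "\<dots> = (\<Sum>(j, m, n)\<in>{1..<M} \<times> off_diag N. a j * cos (2 * pi * (real j * (x m - x n)) * \<alpha>))"
    by (simp add: sum.cartesian_product split_beta)
  finally show ?thesis unfolding card_off_diag by linarith
qed

text \<open>A pair of triples corresponds to a sextuple of the sum on the right, whose indices come
  in a different order. Sextuples outside the image only add nonnegative terms.\<close>

lemma close_pairs_le:
  fixes x :: "nat \<Rightarrow> real"
  assumes "finite J" "K \<subseteq> J"
  shows "(\<Sum>i\<in>K \<times> off_diag N. \<Sum>k\<in>K \<times> off_diag N.
      if \<bar>(case i of (j, m, n) \<Rightarrow> real j * (x m - x n)) - (case k of (j, m, n) \<Rightarrow> real j * (x m - x n))\<bar> < 1
      then 1 else 0)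
    \<le> (\<Sum>j1\<in>J. \<Sum>j2\<in>J. \<Sum>m1\<in>{1..N}. \<Sum>m2\<in>{1..N}. \<Sum>n1\<in>{1..N}. \<Sum>n2\<in>{1..N}.
         if m1 \<noteq> n1 \<and> m2 \<noteq> n2 \<and> \<bar>real j1 * (x m1 - x n1) - real j2 * (x m2 - x n2)\<bar> < 1
         then (1::real) else 0)"
  unfolding sum.cartesian_product
proof (rule sum_le_included[where i = "\<lambda>(j1, j2, m1, m2, n1, n2). ((j1, m1, n1), (j2, m2, n2))"], goal_cases)
  case 1 show ?case using finite_subset[OF assms(2,1)] by (simp add: finite_off_diag)
next
  case 2 show ?case using assms by simp
next
  case 3 show ?case by auto
next
  case 4
  show ?case
    using assms(2) by (auto simp: off_diag_def)
qed

text \<open>The counting sum of the hypothesis with a free cutoff \<open>K\<close>, kept in the same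
  order of summation so that the two agree after unfolding.\<close>

definition close_count :: "(nat \<Rightarrow> real) \<Rightarrow> nat \<Rightarrow> real \<Rightarrow> real" where
  "close_count x N K =
     (\<Sum>j1\<in>{j::nat. 1 \<le> j \<and> real j < K}. \<Sum>j2\<in>{j::nat. 1 \<le> j \<and> real j < K}.
      \<Sum>m1\<in>{1..N}. \<Sum>m2\<in>{1..N}. \<Sum>n1\<in>{1..N}. \<Sum>n2\<in>{1..N}.
         if m1 \<noteq> n1 \<and> m2 \<noteq> n2 \<and> \<bar>real j1 * (x m1 - x n1) - real j2 * (x m2 - x n2)\<bar> < 1
         then (1::real) else 0)"

text \<open>The exceptional set is only enclosed in the compact set where the cosine sum is large,
  so no measurability of \<open>delta_min\<close> in \<alpha> has to be proved.\<close>

lemma exceptional_set_small: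
  fixes x :: "nat \<Rightarrow> real" and T K :: real
  assumes N: "N \<ge> 2" and K: "K > 1" and T: "T \<ge> 1"
  obtains S where "S \<in> lmeasurable"
    "{\<alpha>\<in>{-T/2..T/2}. delta_min \<alpha> x N > 2 / K} \<subseteq> S"
    "measure lebesgue S * real N ^ 4 \<le> 78336 * T * close_count x N K"
proof -
  \<comment> \<open>With the ceiling, \<open>j < M\<close> forces \<open>j < K\<close>, so every
    frequency of the minorant is counted, while \<open>2 / M <= 2 / K\<close>.\<close>
  define M where "M = nat \<lceil>K\<rceil>"
  have M2: "M \<ge> 2" using K unfolding M_def by linarith
  have MK: "real M \<ge> K" unfolding M_def by (rule real_nat_ceiling_ge)
  have jK: "real j < K" if "j < M" for j using that unfolding M_def by linarith
  obtain a :: "nat \<Rightarrow> real" where a24: "\<And>j. \<bar>a j\<bar> \<le> 24"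
    and a: "\<And>t. dist_int t \<ge> 2 / real M \<Longrightarrow> 1 + (\<Sum>j\<in>{1..<M}. a j * cos (real j * (2 * pi * t))) \<le> 0"
    using minorant_polynomial[OF M2] by blast
  define I where "I = {1..<M} \<times> off_diag N"
  define y where "y = (\<lambda>(j, m, n). real j * (x m - x n))"
  define a' where "a' = (\<lambda>i :: nat \<times> nat \<times> nat. a (fst i))"
  define s where "s = real N * (real N - 1)"
  have s0: "s > 0" using N by (simp add: s_def)
  define S where "S = {\<alpha>\<in>{-T/2..T/2}. \<bar>\<Sum>i\<in>I. a' i * cos (2 * pi * y i * \<alpha>)\<bar> \<ge> s}"
  have I: "finite I" by (simp add: I_def finite_off_diag)
  have a'24: "\<bar>a' i\<bar> \<le> 24" for i by (simp add: a'_def a24)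
  note large = measure_large_values_le[where a = a' and y = y and b = 24, OF I T a'24 s0, folded S_def]
  show thesis
  proof (rule that[OF large(1)])
    show "{\<alpha>\<in>{-T/2..T/2}. delta_min \<alpha> x N > 2 / K} \<subseteq> S"
    proof safe
      fix \<alpha> assume \<alpha>: "\<alpha> \<in> {-T/2..T/2}" and "2 / K < delta_min \<alpha> x N"
      moreover have "2 / real M \<le> 2 / K" using MK K by (intro divide_left_mono) auto
      ultimately have "delta_min \<alpha> x N \<ge> 2 / real M" by linarith
      then have "s \<le> \<bar>\<Sum>i\<in>I. a' i * cos (2 * pi * y i * \<alpha>)\<bar>"
        using delta_min_large_imp[OF a] by (simp add: s_def I_def a'_def y_def split_beta)
      with \<alpha> show "\<alpha> \<in> S" by (simp add: S_def)
    qed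
    have "finite {j::nat. 1 \<le> j \<and> real j < K}"
      by (rule finite_subset[of _ "{..M}"]) (use MK in auto)
    moreover have "{1..<M} \<subseteq> {j::nat. 1 \<le> j \<and> real j < K}" using jK by auto
    ultimately have "(\<Sum>i\<in>I. \<Sum>k\<in>I. if \<bar>y i - y k\<bar> < 1 then 1 else 0) \<le> close_count x N K"
      unfolding close_count_def I_def y_def by (rule close_pairs_le)
    then have "34 * T * 24\<^sup>2 * (\<Sum>i\<in>I. \<Sum>k\<in>I. if \<bar>y i - y k\<bar> < 1 then 1 else 0)
        \<le> 34 * T * 24\<^sup>2 * close_count x N K"
      using T by (intro mult_left_mono) auto
    \<comment> \<open>Here \<open>78336 = 4 * 34 * 24^2\<close>; the factor 4 pays for replacing
      \<open>s^2\<close> by \<open>N^4 / 4\<close>, since \<open>N - 1 >= N / 2\<close>.\<close>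
    then have "4 * (measure lebesgue S * s\<^sup>2) \<le> 78336 * T * close_count x N K"
      using large(2) by simp
    moreover have "measure lebesgue S * (real N ^ 4 / 4) \<le> measure lebesgue S * s\<^sup>2"
    proof (rule mult_left_mono)
      have "real N * (real N / 2) \<le> s" unfolding s_def using N by (intro mult_left_mono) auto
      then have "(real N * (real N / 2))\<^sup>2 \<le> s\<^sup>2" by (intro power_mono) auto
      then show "real N ^ 4 / 4 \<le> s\<^sup>2" by (simp add: power_mult_distrib power_divide flip: power_add)
    qed simp
    ultimately show "measure lebesgue S * real N ^ 4 \<le> 78336 * T * close_count x N K" by simp
  qed
qed

section \<open>Dyadic scales and the Borel-Cantelli lemma\<close>

lemma delta_min_le_of_dyadic:
  fixes \<gamma> :: real
  assumes "\<gamma> \<ge> 0" and ev: "eventually (\<lambda>r. delta_min \<alpha> x (2 ^ r) \<le> 2 / real (2 ^ r) powr \<gamma>) sequentially"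
  shows "\<exists>C. \<forall>N\<ge>2. delta_min \<alpha> x N \<le> C / real N powr \<gamma>"
proof -
  obtain r0 where r0: "\<And>r. r \<ge> r0 \<Longrightarrow> delta_min \<alpha> x (2 ^ r) \<le> 2 / real (2 ^ r) powr \<gamma>"
    using ev unfolding eventually_sequentially by blast
  \<comment> \<open>The first summand covers the loss in passing from \<open>N\<close> to the power
    of 2 just below it; the second covers the finitely many small \<open>N\<close>, where
    \<open>delta_min\<close> is at most 1.\<close>
  define C where "C = 2 * 2 powr \<gamma> + real (2 ^ (r0 + 1)) powr \<gamma>"
  have "delta_min \<alpha> x N \<le> C / real N powr \<gamma>" if N: "N \<ge> 2" for N
  proof (cases "N \<ge> 2 ^ (r0 + 1)")
    case True
    obtain k where k: "2 ^ k \<le> N" "N < 2 ^ (k + 1)" using ex_power_ivl1[of 2 N] N by auto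
    have "(2::nat) ^ (r0 + 1) < 2 ^ (k + 1)" using True k(2) by (rule le_less_trans)
    then have "r0 < k" by simp
    have "(2::nat) ^ 1 \<le> 2 ^ k" using \<open>r0 < k\<close> by (intro power_increasing) auto
    then have "delta_min \<alpha> x N \<le> delta_min \<alpha> x (2 ^ k)" using k(1) by (intro delta_min_antimono) auto
    also have "\<dots> \<le> 2 / real (2 ^ k) powr \<gamma>" using \<open>r0 < k\<close> by (intro r0) simp
    also have "\<dots> = 2 * 2 powr \<gamma> / (2 * real (2 ^ k)) powr \<gamma>" by (simp add: powr_mult)
    also have "\<dots> \<le> 2 * 2 powr \<gamma> / real N powr \<gamma>"
    proof (intro divide_left_mono powr_mono2 mult_pos_pos)
      have "real N \<le> real (2 ^ (k + 1))" using k(2) by linarith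
      then show "real N \<le> 2 * real (2 ^ k)" by simp
    qed (use N assms in auto)
    also have "\<dots> \<le> C / real N powr \<gamma>" unfolding C_def by (intro divide_right_mono) auto
    finally show ?thesis .
  next
    case False
    then have "real N \<le> real (2 ^ (r0 + 1))" by linarith
    then have "real N powr \<gamma> \<le> real (2 ^ (r0 + 1)) powr \<gamma>" using assms by (intro powr_mono2) auto
    also have "\<dots> \<le> C" by (simp add: C_def)
    finally have "1 \<le> C / real N powr \<gamma>" using N by (simp add: le_divide_eq)
    moreover have "delta_min \<alpha> x N \<le> 1"
      using delta_min_le[of 1 N 2 \<alpha> x] dist_int_le_1[of "\<alpha> * x 1 - \<alpha> * x 2"] N by auto
    ultimately show ?thesis by linarith
  qed
  then show ?thesis by blast
qed

text \<open>Dividing the count by \<open>N^4\<close> leaves \<open>N powr (- \<epsilon>)\<close>, so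
  along powers of 2 the measures of the exceptional sets are dominated by a convergent geometric
  series.\<close>

lemma AE_interval_delta_min:
  fixes \<gamma> \<epsilon> C T :: real
  assumes \<gamma>: "\<gamma> > 0" and \<epsilon>: "\<epsilon> > 0" and T: "T \<ge> 1"
    and count: "\<And>N. N \<ge> 1 \<Longrightarrow> close_count x N (real N powr \<gamma>) \<le> C * real N powr (4 - \<epsilon>)"
  shows "AE \<alpha> in lebesgue. \<alpha> \<in> {-T/2..T/2} \<longrightarrow>
           (\<exists>C. \<forall>N\<ge>2. delta_min \<alpha> x N \<le> C / real N powr \<gamma>)"
proof -
  \<comment> \<open>The exponent \<open>Suc r\<close> keeps every scale at least 2, as
    \<open>exceptional_set_small\<close> requires; the shift is undone at the end by
    \<open>eventually_sequentially_Suc\<close>.\<close>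
  define N where "N = (\<lambda>r::nat. (2::nat) ^ Suc r)"
  have N2: "N r \<ge> 2" for r by (simp add: N_def)
  have "\<exists>S. S \<in> lmeasurable \<and> {\<alpha>\<in>{-T/2..T/2}. delta_min \<alpha> x (N r) > 2 / (real (N r) powr \<gamma>)} \<subseteq> S
    \<and> measure lebesgue S * real (N r) ^ 4 \<le> 78336 * T * close_count x (N r) (real (N r) powr \<gamma>)" for r
  proof -
    have "real (N r) > 1" using N2[of r] by linarith
    then have "real (N r) powr \<gamma> > 1" using \<gamma> by simp
    show ?thesis
      by (rule exceptional_set_small[OF N2 \<open>real (N r) powr \<gamma> > 1\<close> T, of x]) (rule exI, intro conjI)
  qed
  then have "\<exists>S. \<forall>r. S r \<in> lmeasurable \<and> {\<alpha>\<in>{-T/2..T/2}. delta_min \<alpha> x (N r) > 2 / (real (N r) powr \<gamma>)} \<subseteq> S r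
    \<and> measure lebesgue (S r) * real (N r) ^ 4 \<le> 78336 * T * close_count x (N r) (real (N r) powr \<gamma>)"
    by (intro choice allI)
  then obtain S where lm: "\<And>r. S r \<in> lmeasurable"
    and sub: "\<And>r. {\<alpha>\<in>{-T/2..T/2}. delta_min \<alpha> x (N r) > 2 / (real (N r) powr \<gamma>)} \<subseteq> S r"
    and meas: "\<And>r. measure lebesgue (S r) * real (N r) ^ 4 \<le> 78336 * T * close_count x (N r) (real (N r) powr \<gamma>)"
    by blast
  have bound: "measure lebesgue (S r) \<le> 78336 * T * C * (2 powr (- \<epsilon>)) ^ Suc r" for r
  proof -
    define n where "n = real (N r)"
    have n: "n > 0" by (simp add: n_def N_def)
    have "measure lebesgue (S r) * n ^ 4 \<le> 78336 * T * (C * n powr (4 - \<epsilon>))"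
      unfolding n_def
      by (rule order_trans[OF meas]) (use T N2[of r] in \<open>intro mult_left_mono count; simp\<close>)
    also have "n powr (4 - \<epsilon>) = n powr (- \<epsilon>) * n ^ 4"
      using n powr_add[of n "- \<epsilon>" 4] by (simp add: powr_numeral)
    also have "n powr (- \<epsilon>) = (2 powr (- \<epsilon>)) ^ Suc r"
    proof -
      have "n = 2 powr real (Suc r)" by (simp add: n_def N_def powr_realpow powr_add)
      then show ?thesis by (simp only: powr_powr powr_realpow[symmetric] powr_gt_zero) (simp add: powr_powr mult.commute)
    qed
    finally have "measure lebesgue (S r) * n ^ 4 \<le> 78336 * T * C * (2 powr (- \<epsilon>)) ^ Suc r * n ^ 4"
      by (simp only: mult.assoc)
    then show ?thesis using n by (simp only: mult_le_cancel_right_pos zero_less_power)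
  qed
  have "AE \<alpha> in lebesgue. eventually (\<lambda>r. \<alpha> \<in> space lebesgue - S r) sequentially"
  proof (rule borel_cantelli_AE1)
    have "2 powr (- \<epsilon>) < (1::real)" using \<epsilon> powr_less_mono[of "- \<epsilon>" 0 2] by simp
    then have "summable (\<lambda>r. 78336 * T * C * (2 powr (- \<epsilon>)) ^ Suc r)"
      by (intro summable_mult summable_Suc_iff[THEN iffD2] summable_geometric) simp
    then show "summable (\<lambda>r. measure lebesgue (S r))"
      by (rule summable_comparison_test') (use bound in simp)
    show "S r \<in> sets lebesgue" "emeasure lebesgue (S r) < \<infinity>" for r
      using lm[of r] by (auto simp: fmeasurable_def)
  qed
  then show ?thesis
  proof eventually_elim
    case (elim \<alpha>)
    show ?case
    proof
      assume \<alpha>: "\<alpha> \<in> {-T/2..T/2}"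
      from elim have "eventually (\<lambda>r. delta_min \<alpha> x (2 ^ Suc r) \<le> 2 / real (2 ^ Suc r) powr \<gamma>) sequentially"
      proof eventually_elim
        case (elim r)
        then show ?case using \<alpha> sub[of r] by (force simp: N_def)
      qed
      then have "eventually (\<lambda>r. delta_min \<alpha> x (2 ^ r) \<le> 2 / real (2 ^ r) powr \<gamma>) sequentially"
        by (rule eventually_sequentially_Suc[THEN iffD1])
      then show "\<exists>C. \<forall>N\<ge>2. delta_min \<alpha> x N \<le> C / real N powr \<gamma>"
        using \<gamma> by (intro delta_min_le_of_dyadic) auto
    qed
  qed
qed

theorem theorem2:
  fixes \<beta> c :: real and x :: "nat \<Rightarrow> real"
  assumes "1 < \<beta>" and "\<beta> \<le> 2"
    and "c > 0" and "\<And>n. n \<ge> 1 \<Longrightarrow> x (n + 1) - x n \<ge> c"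
    and "\<forall>\<epsilon>>0. \<exists>C::real. \<forall>N::nat. N \<ge> 1 \<longrightarrow>
      (\<Sum>j1\<in>{j::nat. 1 \<le> j \<and> real j < real N powr (\<beta> - \<epsilon>)}.
       \<Sum>j2\<in>{j::nat. 1 \<le> j \<and> real j < real N powr (\<beta> - \<epsilon>)}.
       \<Sum>m1\<in>{1..N}. \<Sum>m2\<in>{1..N}. \<Sum>n1\<in>{1..N}. \<Sum>n2\<in>{1..N}.
         if m1 \<noteq> n1 \<and> m2 \<noteq> n2 \<and>
            \<bar>real j1 * (x m1 - x n1) - real j2 * (x m2 - x n2)\<bar> < 1
         then (1::real) else 0)
      \<le> C * real N powr (4 - \<epsilon>)"
  shows "AE \<alpha> in lborel. \<forall>\<epsilon>>0. \<exists>C::real. \<forall>N::nat. N \<ge> 2 \<longrightarrow>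
           delta_min \<alpha> x N \<le> C / real N powr (\<beta> - \<epsilon>)"
proof -
  \<comment> \<open>A null set may be discarded for each of countably many parameters only, so
    \<epsilon> runs through \<open>1 / (k + 1)\<close> and \<alpha> through intervals exhausting the
    line. Since \<open>e k <= 1 < \<beta>\<close>, the exponent \<open>\<beta> - e k\<close> is
    positive.\<close>
  define e where "e = (\<lambda>k::nat. 1 / real (Suc k))"
  have "AE \<alpha> in lebesgue. \<alpha> \<in> {-real (Suc n)/2..real (Suc n)/2} \<longrightarrow>
      (\<exists>C. \<forall>N\<ge>2. delta_min \<alpha> x N \<le> C / real N powr (\<beta> - e k))" for n k
  proof -
    have e: "e k > 0" "e k \<le> 1" by (simp_all add: e_def)
    obtain C where C: "\<And>N. N \<ge> 1 \<Longrightarrow>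
        close_count x N (real N powr (\<beta> - e k)) \<le> C * real N powr (4 - e k)"
      using assms(5)[rule_format, OF e(1)] unfolding close_count_def by blast
    show ?thesis
      by (rule AE_interval_delta_min[OF _ e(1) _ C]) (use e assms(1) in auto)
  qed
  then have "AE \<alpha> in lebesgue. \<forall>n k. \<alpha> \<in> {-real (Suc n)/2..real (Suc n)/2} \<longrightarrow>
      (\<exists>C. \<forall>N\<ge>2. delta_min \<alpha> x N \<le> C / real N powr (\<beta> - e k))"
    by (simp only: AE_all_countable) blast
  then have "AE \<alpha> in lebesgue. \<forall>\<epsilon>>0. \<exists>C::real. \<forall>N::nat. N \<ge> 2 \<longrightarrow>
           delta_min \<alpha> x N \<le> C / real N powr (\<beta> - \<epsilon>)"
  proof eventually_elim
    case (elim \<alpha>)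
    show ?case
    proof (intro allI impI)
      fix \<epsilon> :: real assume "\<epsilon> > 0"
      then obtain k where "inverse (real (Suc k)) < \<epsilon>" using reals_Archimedean by blast
      then have k: "e k \<le> \<epsilon>" by (simp add: e_def inverse_eq_divide)
      obtain n :: nat where "real n \<ge> 2 * \<bar>\<alpha>\<bar>" using real_arch_simple by blast
      then have "\<alpha> \<in> {-real (Suc n)/2..real (Suc n)/2}" by auto
      with elim obtain C where C: "\<And>N. N \<ge> 2 \<Longrightarrow> delta_min \<alpha> x N \<le> C / real N powr (\<beta> - e k)"
        by blast
      \<comment> \<open>Passing from \<open>e k\<close> to the larger \<epsilon> weakens the bound
        only if the numerator is nonnegative, hence the absolute value of \<open>C\<close>.\<close>
      have "delta_min \<alpha> x N \<le> \<bar>C\<bar> / real N powr (\<beta> - \<epsilon>)" if N: "N \<ge> 2" for N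
      proof -
        have "delta_min \<alpha> x N \<le> C / real N powr (\<beta> - e k)" by (rule C[OF N])
        also have "\<dots> \<le> \<bar>C\<bar> / real N powr (\<beta> - e k)" by (intro divide_right_mono) auto
        also have "\<dots> \<le> \<bar>C\<bar> / real N powr (\<beta> - \<epsilon>)"
          using N k by (intro divide_left_mono powr_mono mult_pos_pos) auto
        finally show ?thesis .
      qed
      then show "\<exists>C. \<forall>N\<ge>2. delta_min \<alpha> x N \<le> C / real N powr (\<beta> - \<epsilon>)" by blast
    qed
  qed
  \<comment> \<open>\<open>lebesgue\<close> is the completion of \<open>lborel\<close>, and
    completion does not change which properties hold almost everywhere.\<close>
  then show ?thesis by (simp only: AE_completion_iff)
qed

end
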